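(* Let $k$ be a positive integer, let $n\ge \frac{9}{2}k^2+\frac{13}{4}k+\frac{49}{32}$ be an integer, and let $\alpha\in\{-1,1\}$. Then $$\mathrm{lbal}(n,C_{4k+\alpha})=\mathrm{bal}(n,C_{4k+\alpha})=\mathrm{bal}(n,P_{4k+\alpha-1})=(k-1)n-\frac{1}{2}\left(k^2-k-1-\alpha\right).$$
   Context: $C_\ell$ is the cycle on $\ell$ vertices, and $P_\ell$ is the path with $\ell$ edges (hence $\ell+1$ vertices). A 2-coloring of the edges of $K_n$ is a partition $E(K_n)=R\sqcup B$ (red edges and blue edges). A 2-list coloring of the edges of $K_n$ is a function $L:E(K_n)\to\{\{r\},\{b\},\{r,b\}\}$; it induces color classes $R=\{e: r\in L(e)\}$ and $B=\{e: b\in L(e)\}$ (which may intersect). Given a 2-coloring or a 2-list coloring with color classes $R,B$, a balanced copy of a graph $G=G(V,E)$ is a (not necessarily induced) copy of $G$ in $K_n$ whose edge set has a partition $E_1\sqcup E_2$ with $E_1\subseteq R$, $E_2\subseteq B$ and $\bigl||E_1|-|E_2|\bigr|\le 1$. Balancing number: $\mathrm{bal}(n,G)$ is the smallest integer $k$ such that every 2-coloring $R\sqcup B$ of the edges of $K_n$ with $|R|,|B|>k$ contains a balanced copy of $G$, where the condition $|R|,|B|>k$ is required to be satisfiable by some 2-coloring, i.e. $2(k+1)\le\binom{n}{2}$. List balancing number: for $n\ge |V|$, $\mathrm{lbal}(n,G)$ is the smallest integer $k$ such that every 2-list coloring of the edges of $K_n$ with color classes satisfying $|R|,|B|>k$ contains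 a balanced copy of $G$. *)

theory Defs
  imports Complex_Main
begin

type_synonym 'a graph = "'a set \<times> 'a set set"

abbreviation gverts :: "'a graph \<Rightarrow> 'a set" where "gverts G \<equiv> fst G"
abbreviation gedges :: "'a graph \<Rightarrow> 'a set set" where "gedges G \<equiv> snd G"

text \<open>Edges of the complete graph on the vertex set \<open>{0, \<dots>, n - 1}\<close>.\<close>
definition K_edges :: "nat \<Rightarrow> nat set set" where
  "K_edges n = {e. e \<subseteq> {..<n} \<and> card e = 2}"

text \<open>A genuine simple cycle only for \<open>l \<ge> 3\<close>.\<close>
definition cycle_graph :: "nat \<Rightarrow> nat graph" where
  "cycle_graph l = ({..<l}, {{i, (i + 1) mod l} | i. i < l})"

text \<open>The path with \<open>l\<close> edges, hence \<open>l + 1\<close> vertices.\<close>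
definition path_graph :: "nat \<Rightarrow> nat graph" where
  "path_graph l = ({..l}, {{i, i + 1} | i. i < l})"

text \<open>\<open>F\<close> is the edge set of a (not necessarily induced) copy of \<open>G\<close> in the complete graph
  on \<open>{0, \<dots>, n - 1}\<close>.\<close>
definition copy_in_K :: "nat \<Rightarrow> 'a graph \<Rightarrow> nat set set \<Rightarrow> bool" where
  "copy_in_K n G F \<longleftrightarrow>
     (\<exists>f. inj_on f (gverts G) \<and> f ` gverts G \<subseteq> {..<n} \<and> F = (\<lambda>e. f ` e) ` gedges G)"

definition has_balanced_copy ::
  "nat \<Rightarrow> 'a graph \<Rightarrow> nat set set \<Rightarrow> nat set set \<Rightarrow> bool" where
  "has_balanced_copy n G R B \<longleftrightarrow>
     (\<exists>F E1 E2. copy_in_K n G F \<and> F = E1 \<union> E2 \<and> E1 \<inter> E2 = {} \<and> E1 \<subseteq> R \<and> E2 \<subseteq> B \<and>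
        \<bar>int (card E1) - int (card E2)\<bar> \<le> 1)"

definition two_coloring :: "nat \<Rightarrow> nat set set \<Rightarrow> nat set set \<Rightarrow> bool" where
  "two_coloring n R B \<longleftrightarrow> R \<union> B = K_edges n \<and> R \<inter> B = {}"

datatype color = Red | Blue

definition two_list_coloring :: "nat \<Rightarrow> (nat set \<Rightarrow> color set) \<Rightarrow> bool" where
  "two_list_coloring n L \<longleftrightarrow> (\<forall>e\<in>K_edges n. L e \<in> {{Red}, {Blue}, {Red, Blue}})"

definition color_class :: "nat \<Rightarrow> (nat set \<Rightarrow> color set) \<Rightarrow> color \<Rightarrow> nat set set" where
  "color_class n L c = {e \<in> K_edges n. c \<in> L e}"

text \<open>The smallest integer satisfying \<open>P\<close>; \<open>None\<close> if there is no smallest one.\<close>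
definition smallest_int :: "(int \<Rightarrow> bool) \<Rightarrow> int option" where
  "smallest_int P =
     (if \<exists>m. P m \<and> (\<forall>j. P j \<longrightarrow> m \<le> j) then Some (LEAST m. P m) else None)"

text \<open>\<open>bal n G = None\<close> when the balancing number does not exist. The first conjunct says that
  some 2-coloring has more than \<open>m\<close> edges in each color.\<close>
definition bal :: "nat \<Rightarrow> 'a graph \<Rightarrow> int option" where
  "bal n G = smallest_int (\<lambda>m. 2 * (m + 1) \<le> int (n choose 2) \<and>
     (\<forall>R B. two_coloring n R B \<and> int (card R) > m \<and> int (card B) > m
        \<longrightarrow> has_balanced_copy n G R B))"

text \<open>Only defined if \<open>n\<close> is at least the number of vertices of \<open>G\<close>.\<close>
definition lbal :: "nat \<Rightarrow> 'a graph \<Rightarrow> int option" where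
  "lbal n G = smallest_int (\<lambda>m. card (gverts G) \<le> n \<and>
     (\<forall>L. two_list_coloring n L \<and>
        int (card (color_class n L Red)) > m \<and> int (card (color_class n L Blue)) > m
        \<longrightarrow> has_balanced_copy n G (color_class n L Red) (color_class n L Blue)))"

end

theory Submission
  imports Defs
begin

text \<open>
  Write the cycle length as \<open>2s + 1\<close>. A cycle is balanced iff at least \<open>s\<close> of its edges can be taken red
  and at least \<open>s\<close> blue. Sufficiently many red edges yield a cycle with at least \<open>s\<close> red edges: as long
  as there is a vertex of degree at least \<open>2s - 2\<close>, delete it and use it later as the centre of a
  red path with two edges (lowering \<open>s\<close> by two); otherwise the degrees are so small that a
  greedy red matching with \<open>s\<close> edges exists. Likewise for blue. One then moves from the red-rich cycle to the
  blue-rich one by replacing a single vertex at a time. Each move changes the number of blue edges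
  by at most 2, so the two consecutive values \<open>s\<close>, \<open>s + 1\<close> cannot both be skipped. Deleting an edge
  of the majority color from a balanced odd cycle leaves a balanced path.

  For the lower bounds, color red all edges meeting a fixed set of \<open>k - 1\<close> vertices, and one
  further edge if \<open>\<alpha> = 1\<close>: cycles and paths have degree at most 2, so they contain fewer
  than \<open>s\<close> red edges.
\<close>

section \<open>Paths with many edges in a dense graph\<close>

text \<open>A list is read as a path of the complete graph whose steps outside \<open>E\<close> are
  allowed but not counted, so lists can be concatenated freely.\<close>

fun edge_count :: "'a set set \<Rightarrow> 'a list \<Rightarrow> nat" where
  "edge_count E (x # y # zs) = of_bool ({x, y} \<in> E) + edge_count E (y # zs)"
| "edge_count E _ = 0"

lemma edge_count_append: "edge_count E xs + edge_count E ys \<le> edge_count E (xs @ ys)"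
proof (induction E xs rule: edge_count.induct)
  case ("2_2" E x)
  show ?case by (cases ys) auto
qed auto

lemma edge_count_mono: "E \<subseteq> E' \<Longrightarrow> edge_count E xs \<le> edge_count E' xs"
  by (induction E xs rule: edge_count.induct) (auto intro: le_SucI)

lemma edge_count_eq_card:
  "edge_count E xs = card {i. Suc i < length xs \<and> {xs ! i, xs ! Suc i} \<in> E}"
proof (induction E xs rule: edge_count.induct)
  case (1 E x y zs)
  let ?A = "{i. Suc i < length (y # zs) \<and> {(y # zs) ! i, (y # zs) ! Suc i} \<in> E}"
  have "{i. Suc i < length (x # y # zs) \<and> {(x # y # zs) ! i, (x # y # zs) ! Suc i} \<in> E}
      = (if {x, y} \<in> E then {0} else {}) \<union> Suc ` ?A" (is "?L = ?R")
  proof (rule set_eqI)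
    fix i show "i \<in> ?L \<longleftrightarrow> i \<in> ?R" by (cases i) auto
  qed
  moreover have "finite ?A" by (rule finite_subset[of _ "{..<length (y # zs)}"]) auto
  ultimately show ?case using 1 by (auto simp: card_image card_Un_disjoint)
qed auto

lemma finite_edges: "finite U \<Longrightarrow> E \<subseteq> {e. e \<subseteq> U \<and> card e = 2} \<Longrightarrow> finite E"
  by (rule finite_subset[of _ "Pow U"]) auto

text \<open>Greedy matching: an edge \<open>{u, v}\<close> lies in the stars of both its ends, so
  deleting \<open>u\<close> and \<open>v\<close> destroys at most \<open>2 * d - 1\<close> edges.
  The matching edges are strung together in one list.\<close>

lemma bounded_degree_path:
  assumes "finite U" "E \<subseteq> {e. e \<subseteq> U \<and> card e = 2}" "\<And>x. card {e \<in> E. x \<in> e} \<le> d"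
    "m * (2 * d - 1) < card E"
  shows "\<exists>xs. distinct xs \<and> set xs \<subseteq> U \<and> length xs = 2 * (m + 1) \<and> m + 1 \<le> edge_count E xs"
  using assms
proof (induction m arbitrary: U E)
  case 0
  then have "E \<noteq> {}" by auto
  then obtain e where e: "e \<in> E" by blast
  with 0(2) have "e \<subseteq> U" "card e = 2" by auto
  then obtain u v where "e = {u, v}" "u \<noteq> v" by (meson card_2_iff)
  then show ?case using e \<open>e \<subseteq> U\<close> by (intro exI[of _ "[u, v]"]) auto
next
  case (Suc m)
  have fin: "finite E" using Suc.prems finite_edges by blast
  have "E \<noteq> {}" using Suc.prems(4) by auto
  then obtain e where e: "e \<in> E" by blast
  with Suc.prems(2) have "e \<subseteq> U" "card e = 2" by auto
  then obtain u v where uv: "e = {u, v}" "u \<noteq> v" "u \<in> U" "v \<in> U"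
    by (metis card_2_iff insert_subset)
  define E' where "E' = {e \<in> E. u \<notin> e \<and> v \<notin> e}"
  let ?D = "\<lambda>x. {e \<in> E. x \<in> e}"
  have "card (?D u \<union> ?D v) + card (?D u \<inter> ?D v) = card (?D u) + card (?D v)"
    using card_Un_Int[of "?D u" "?D v"] fin by simp
  moreover have "e \<in> ?D u \<inter> ?D v" using e uv by auto
  then have "card (?D u \<inter> ?D v) > 0" using fin by (auto simp: card_gt_0_iff)
  ultimately have "card (?D u \<union> ?D v) \<le> 2 * d - 1"
    using Suc.prems(3)[of u] Suc.prems(3)[of v] by linarith
  moreover have "E = E' \<union> (?D u \<union> ?D v)" unfolding E'_def by auto
  then have "card E \<le> card E' + card (?D u \<union> ?D v)" by (metis card_Un_le)
  ultimately have big: "m * (2 * d - 1) < card E'" using Suc.prems(4) by simp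
  have sub: "E' \<subseteq> {e. e \<subseteq> U - {u, v} \<and> card e = 2}" using Suc.prems(2) by (auto simp: E'_def)
  have deg: "card {e \<in> E'. x \<in> e} \<le> d" for x
    by (rule order_trans[OF card_mono Suc.prems(3)[of x]]) (use fin in \<open>auto simp: E'_def\<close>)
  obtain xs where xs: "distinct xs" "set xs \<subseteq> U - {u, v}" "length xs = 2 * (m + 1)"
      "m + 1 \<le> edge_count E' xs"
    using Suc.IH[OF finite_Diff[OF Suc.prems(1)] sub deg big] by blast
  have "edge_count E' xs \<le> edge_count E xs" by (rule edge_count_mono) (auto simp: E'_def)
  moreover have "edge_count E [u, v] = 1" using e uv by simp
  ultimately have "Suc m + 1 \<le> edge_count E ([u, v] @ xs)"
    using edge_count_append[of E "[u, v]" xs] xs(4) by linarith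
  then show ?case using xs uv by (intro exI[of _ "[u, v] @ xs"]) auto
qed

lemma card_neighbours:
  assumes "E \<subseteq> {e. e \<subseteq> U \<and> card e = 2}"
  shows "card {y. {x, y} \<in> E} = card {e \<in> E. x \<in> e}"
proof (rule bij_betw_same_card[of "\<lambda>y. {x, y}"])
  have "e \<in> (\<lambda>y. {x, y}) ` {y. {x, y} \<in> E}" if "e \<in> E" "x \<in> e" for e
  proof -
    have "card e = 2" using that assms by auto
    then obtain a b where ab: "e = {a, b}" by (meson card_2_iff)
    with that have "e = {x, a} \<or> e = {x, b}" by auto
    with that show ?thesis by auto
  qed
  then show "bij_betw (\<lambda>y. {x, y}) {y. {x, y} \<in> E} {e \<in> E. x \<in> e}"
    by (auto simp: bij_betw_def inj_on_def doubleton_eq_iff)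
qed

text \<open>At most \<open>length xs\<close> neighbours of \<open>x\<close> lie on
  \<open>xs\<close>, so two are left over; the cherry they form with \<open>x\<close> goes in front
  of the list.\<close>

lemma extend_path_by_cherry:
  assumes "finite U" "E \<subseteq> {e. e \<subseteq> U \<and> card e = 2}" "x \<in> U"
    and xs: "distinct xs" "set xs \<subseteq> U - {x}"
    and deg: "length xs + 2 \<le> card {e \<in> E. x \<in> e}" and U: "length xs + 4 \<le> card U"
  shows "\<exists>ys. distinct ys \<and> set ys \<subseteq> U \<and> length ys = length xs + 4 \<and>
    edge_count E xs + 2 \<le> edge_count E ys"
proof -
  let ?N = "{y. {x, y} \<in> E}"
  have N: "?N \<subseteq> U - {x}" using assms(2) by auto
  have "2 \<le> card (?N - set xs)"
    using diff_card_le_card_Diff[of "set xs" ?N] deg distinct_card[OF xs(1)]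
      card_neighbours[OF assms(2), of x] by simp
  then obtain a b where ab: "a \<in> ?N - set xs" "b \<in> ?N - set xs" "a \<noteq> b"
    by (metis card_le_Suc0_iff_eq card.infinite not_less_eq_eq numeral_2_eq_2 zero_le)
  have "card (set (a # b # x # xs)) \<le> length xs + 3" using card_length[of "a # b # x # xs"] by simp
  then have "card (set (a # b # x # xs)) < card U" using U by linarith
  then have "\<not> U \<subseteq> set (a # b # x # xs)"
    using card_mono[of "set (a # b # x # xs)" U] by (meson List.finite_set leD)
  \<comment> \<open>\<open>d\<close> keeps the list twice as long as the number of edges counted.\<close>
  then obtain d where d: "d \<in> U" "d \<notin> set (a # b # x # xs)" by blast
  have "edge_count E [a, x, b, d] \<ge> 2" using ab by (simp add: insert_commute)
  then have "edge_count E xs + 2 \<le> edge_count E ([a, x, b, d] @ xs)"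
    using edge_count_append[of E "[a, x, b, d]" xs] by linarith
  then show ?thesis using ab d xs N assms(3) by (intro exI[of _ "[a, x, b, d] @ xs"]) auto
qed

text \<open>The bound on \<open>card E\<close> is the number of edges meeting a fixed set of \<open>j\<close> vertices, plus \<open>c\<close>;
  it is multiplied by two and rearranged to avoid division and subtraction.\<close>
lemma dense_path:
  assumes "finite U" "E \<subseteq> {e. e \<subseteq> U \<and> card e = 2}" "c \<le> 1" "20 * j + 7 \<le> card U"
    "2 * j * card U + 2 * c < 2 * card E + j * (j + 1)"
  shows "\<exists>xs. distinct xs \<and> set xs \<subseteq> U \<and> length xs = 2 * (2 * j + 1 + c) \<and>
    2 * j + 1 + c \<le> edge_count E xs"
  using assms
proof (induction j arbitrary: U E)
  case 0
  show ?case
  \<comment> \<open>For \<open>c = 1\<close> two edges are wanted: either some vertex is the centre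
    of a cherry, or all degrees are at most 1 and \<open>E\<close> is a matching.\<close>
  proof (cases "c = 1 \<and> (\<exists>x. 2 \<le> card {e \<in> E. x \<in> e})")
    case True
    then obtain x where x: "2 \<le> card {e \<in> E. x \<in> e}" "c = 1" by auto
    then have "{e \<in> E. x \<in> e} \<noteq> {}" by force
    then have "x \<in> U" using 0 by auto
    then show ?thesis using extend_path_by_cherry[of U E x "[]"] x 0 by auto
  next
    case False
    then have "card {e \<in> E. x \<in> e} \<le> 1" if "c = 1" for x
      using that by (simp add: not_le less_Suc_eq_le numeral_2_eq_2)
    \<comment> \<open>For \<open>c = 0\<close> a single edge is enough, so the trivial degree bound
      \<open>card E\<close> will do.\<close>
    then have "\<And>x. card {e \<in> E. x \<in> e} \<le> (if c = 1 then 1 else card E)"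
      using finite_edges[OF 0(1,2)] by (auto intro: card_mono)
    from bounded_degree_path[OF 0(1,2) this, of c] 0 show ?thesis
      by (cases "c = 0") auto
  qed
next
  case (Suc i)
  have fin: "finite E" using Suc.prems finite_edges by blast
  show ?case
  \<comment> \<open>The threshold is \<open>length xs + 2\<close> for the list \<open>xs\<close> of
    length \<open>2 * (2 * i + 1 + c)\<close> that the induction hypothesis supplies.\<close>
  proof (cases "\<exists>x. 4 * i + 4 + 2 * c \<le> card {e \<in> E. x \<in> e}")
    case True
    then obtain x where x: "4 * i + 4 + 2 * c \<le> card {e \<in> E. x \<in> e}" ..
    then have "{e \<in> E. x \<in> e} \<noteq> {}" by force
    then have xU: "x \<in> U" using Suc.prems by auto
    define E' where "E' = {e \<in> E. x \<notin> e}"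
    have "card {y. {x, y} \<in> E} \<le> card (U - {x})"
      using Suc.prems by (intro card_mono) auto
    then have degU: "card {e \<in> E. x \<in> e} \<le> card U - 1"
      using card_neighbours[OF Suc.prems(2), of x] xU Suc.prems(1) by simp
    have "E = E' \<union> {e \<in> E. x \<in> e}" by (auto simp: E'_def)
    then have "card E \<le> card E' + card {e \<in> E. x \<in> e}" by (metis card_Un_le)
    with degU have EE': "card E \<le> card E' + (card U - 1)" by linarith
    obtain N where N: "card U = Suc N" using Suc.prems(4) by (cases "card U") auto
    have U': "card (U - {x}) = N" using N xU Suc.prems(1) by simp
    have "\<exists>xs. distinct xs \<and> set xs \<subseteq> U - {x} \<and> length xs = 2 * (2 * i + 1 + c) \<and>
        2 * i + 1 + c \<le> edge_count E' xs"
    proof (rule Suc.IH)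
      \<comment> \<open>Deleting \<open>x\<close> costs at most \<open>N\<close> edges, and the
        required bound on \<open>2 * card E\<close> drops by exactly \<open>2 * N\<close>.\<close>
      show "2 * i * card (U - {x}) + 2 * c < 2 * card E' + i * (i + 1)"
        using Suc.prems(5) EE' unfolding U' N by (simp add: algebra_simps)
    qed (use Suc.prems U' N in \<open>auto simp: E'_def\<close>)
    then obtain xs where xs: "distinct xs" "set xs \<subseteq> U - {x}" "length xs = 2 * (2 * i + 1 + c)"
        "2 * i + 1 + c \<le> edge_count E' xs" by blast
    have "edge_count E' xs \<le> edge_count E xs" by (rule edge_count_mono) (auto simp: E'_def)
    moreover have "\<exists>ys. distinct ys \<and> set ys \<subseteq> U \<and> length ys = length xs + 4 \<and>
        edge_count E xs + 2 \<le> edge_count E ys"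
      by (rule extend_path_by_cherry[OF Suc.prems(1,2) xU xs(1,2)]) (use x xs Suc.prems in auto)
    ultimately show ?thesis using xs(3,4) by force
  next
    case False
    then have deg: "card {e \<in> E. x \<in> e} \<le> 4 * i + 3 + 2 * c" for x
    proof -
      have "\<not> 4 * i + 4 + 2 * c \<le> card {e \<in> E. x \<in> e}" using False by blast
      then show ?thesis by linarith
    qed
    have eq: "2 * (4 * i + 3 + 2 * c) - 1 = 8 * i + 5 + 4 * c" by simp
    \<comment> \<open>The bound on \<open>card U\<close> yields more than
      \<open>19.5 * i * i + 45.5 * i + 26 + c\<close> edges. The greedy matching needs more than
      \<open>16 * i * i + 42 * i + 27\<close> if \<open>c = 1\<close>, and fewer if
      \<open>c = 0\<close>. For \<open>c = 1\<close> the two bounds agree at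
      \<open>i = 0\<close>.\<close>
    have "Suc i * (20 * Suc i + 7) \<le> Suc i * card U"
      using Suc.prems(4) by (intro mult_left_mono) auto
    then have "20 * (i * i) + 47 * i + 27 \<le> i * card U + card U"
      by (simp add: algebra_simps)
    moreover have "2 * (i * card U) + 2 * card U + 2 * c < 2 * card E + i * i + 3 * i + 2"
      using Suc.prems(5) by (simp add: algebra_simps)
    moreover have "c = 0 \<or> c = 1" using Suc.prems(3) by linarith
    moreover have "(2 * i + 2 + c) * (8 * i + 5 + 4 * c) =
        (if c = 0 then 16 * (i * i) + 26 * i + 10 else 16 * (i * i) + 42 * i + 27)"
      if "c = 0 \<or> c = 1"
      using that by (elim disjE) (simp_all add: algebra_simps)
    ultimately have "(2 * i + 2 + c) * (2 * (4 * i + 3 + 2 * c) - 1) < card E"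
      unfolding eq by (auto split: if_splits)
    from bounded_degree_path[OF Suc.prems(1,2) deg this]
    have "\<exists>xs. distinct xs \<and> set xs \<subseteq> U \<and> length xs = 2 * (2 * i + 2 + c + 1) \<and>
        2 * i + 2 + c + 1 \<le> edge_count E xs" .
    moreover have "2 * i + 2 + c + 1 = 2 * Suc i + 1 + c" by simp
    ultimately show ?thesis by (simp only:)
  qed
qed

section \<open>Cycles and paths as injective labellings\<close>

text \<open>Edges are indexed by position, so that counts for two labellings can be compared index
  by index.\<close>

definition cycle_edge :: "nat \<Rightarrow> (nat \<Rightarrow> 'a) \<Rightarrow> nat \<Rightarrow> 'a set" where
  "cycle_edge l f i = {f i, f (Suc i mod l)}"

lemma copy_in_K_cycle_iff:
  "copy_in_K n (cycle_graph l) F \<longleftrightarrow>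
    (\<exists>f. inj_on f {..<l} \<and> f ` {..<l} \<subseteq> {..<n} \<and> F = cycle_edge l f ` {..<l})"
proof -
  have "(\<lambda>e. f ` e) ` {{i, (i + 1) mod l} | i. i < l} = cycle_edge l f ` {..<l}" for f :: "nat \<Rightarrow> nat"
    by (simp add: setcompr_eq_image image_image cycle_edge_def lessThan_def)
  then show ?thesis by (simp add: copy_in_K_def cycle_graph_def)
qed

lemma copy_in_K_path_iff:
  "copy_in_K n (path_graph l) F \<longleftrightarrow>
    (\<exists>f. inj_on f {..l} \<and> f ` {..l} \<subseteq> {..<n} \<and> F = (\<lambda>i. {f i, f (Suc i)}) ` {..<l})"
proof -
  have "(\<lambda>e. f ` e) ` {{i, i + 1} | i. i < l} = (\<lambda>i. {f i, f (Suc i)}) ` {..<l}" for f :: "nat \<Rightarrow> nat"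
    by (simp add: setcompr_eq_image image_image lessThan_def)
  then show ?thesis by (simp add: copy_in_K_def path_graph_def)
qed

text \<open>Two different indices with the same edge would be cyclic successors of each other, which
  is impossible once \<open>l\<close> is at least 3.\<close>

lemma inj_cycle_edge:
  assumes "inj_on f {..<l}" "3 \<le> l"
  shows "inj_on (cycle_edge l f) {..<l}"
proof (rule inj_onI)
  fix i j assume ij: "i \<in> {..<l}" "j \<in> {..<l}" "cycle_edge l f i = cycle_edge l f j"
  have "Suc i mod l < l" "Suc j mod l < l" using assms by auto
  then have "i = j \<or> (i = Suc j mod l \<and> Suc i mod l = j)"
    using ij assms(1) unfolding cycle_edge_def doubleton_eq_iff
    by (auto simp: inj_on_eq_iff)
  then show "i = j" using ij assms(2) by (auto simp: mod_Suc split: if_splits)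
qed

lemma card_inter_cycle:
  assumes "inj_on f {..<l}" "3 \<le> l"
  shows "card (cycle_edge l f ` {..<l} \<inter> X) = card {i. i < l \<and> cycle_edge l f i \<in> X}"
proof -
  have "cycle_edge l f ` {..<l} \<inter> X = cycle_edge l f ` {i. i < l \<and> cycle_edge l f i \<in> X}" by auto
  moreover have "inj_on (cycle_edge l f) {i. i < l \<and> cycle_edge l f i \<in> X}"
    by (rule inj_on_subset[OF inj_cycle_edge[OF assms]]) auto
  ultimately show ?thesis by (simp add: card_image)
qed

lemma cycle_edges_in_K:
  assumes "inj_on f {..<l}" "f ` {..<l} \<subseteq> {..<n}" "3 \<le> l"
  shows "cycle_edge l f ` {..<l} \<subseteq> K_edges n"
proof
  fix e assume "e \<in> cycle_edge l f ` {..<l}"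
  then obtain i where i: "i < l" "e = {f i, f (Suc i mod l)}" by (auto simp: cycle_edge_def)
  have "Suc i mod l < l" "Suc i mod l \<noteq> i" using i assms(3) by (auto simp: mod_Suc)
  then have "f i \<noteq> f (Suc i mod l)" "f i < n" "f (Suc i mod l) < n"
    using i assms by (auto simp: inj_on_eq_iff image_subset_iff)
  then show "e \<in> K_edges n" using i by (simp add: K_edges_def)
qed

section \<open>Interpolation between two cycles\<close>

text \<open>The value at \<open>i\<close> enters only the edges indexed by \<open>i\<close> and by
  its cyclic predecessor.\<close>

lemma cycle_count_update:
  assumes "i < l"
  shows "card {j. j < l \<and> cycle_edge l (f(i := y)) j \<in> X} \<le> card {j. j < l \<and> cycle_edge l f j \<in> X} + 2"
proof -
  have "{j. j < l \<and> cycle_edge l (f(i := y)) j \<in> X} \<subseteq>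
      {j. j < l \<and> cycle_edge l f j \<in> X} \<union> {i, if i = 0 then l - 1 else i - 1}" (is "_ \<subseteq> ?S \<union> ?T")
    by (auto simp: cycle_edge_def mod_Suc split: if_splits)
  then have "card {j. j < l \<and> cycle_edge l (f(i := y)) j \<in> X} \<le> card (?S \<union> ?T)"
    by (intro card_mono) auto
  also have "\<dots> \<le> card ?S + card ?T" by (rule card_Un_le)
  also have "card ?T \<le> 2" by (simp add: card_insert_if)
  finally show ?thesis by simp
qed

text \<open>A discrete intermediate value argument: \<open>f\<close> is turned into \<open>g\<close>
  one position at a time, by induction on the number of disagreements. The first count that is not
  below \<open>s\<close> is \<open>s\<close> or \<open>s + 1\<close>. Since \<open>l < n\<close>, a
  spare vertex always exists to keep the labelling injective.\<close>

lemma cycle_interpolation: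
  assumes "inj_on f {..<l}" "f ` {..<l} \<subseteq> {..<n}" "inj_on g {..<l}" "g ` {..<l} \<subseteq> {..<n}" "l < n"
    and "card {j. j < l \<and> cycle_edge l f j \<in> X} < s" "s \<le> card {j. j < l \<and> cycle_edge l g j \<in> X}"
  shows "\<exists>h. inj_on h {..<l} \<and> h ` {..<l} \<subseteq> {..<n} \<and>
    card {j. j < l \<and> cycle_edge l h j \<in> X} \<in> {s, s + 1}"
  using assms
proof (induction "card {i. i < l \<and> f i \<noteq> g i}" arbitrary: f rule: less_induct)
  case less
  let ?c = "\<lambda>f. card {j. j < l \<and> cycle_edge l f j \<in> X}"
  let ?D = "\<lambda>f. {i. i < l \<and> f i \<noteq> g i}"
  let ?inj = "\<lambda>f. inj_on f {..<l} \<and> f ` {..<l} \<subseteq> {..<n}"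
  have step: "?c (f'(i := y)) < s \<or> (\<exists>h. ?inj h \<and> ?c h \<in> {s, s + 1})"
    if "?inj (f'(i := y))" "?c f' < s" "i < l" for f' i y
  proof (cases "?c (f'(i := y)) < s")
    case False
    then have "?c (f'(i := y)) = s \<or> ?c (f'(i := y)) = s + 1"
      using that(2) cycle_count_update[OF that(3), of f' y X] by linarith
    then show ?thesis using that(1) by blast
  qed simp
  have upd: "?inj (f'(i := y))" if "?inj f'" "i < l" "y < n" "y \<notin> f' ` {..<l}" for f' i y
    using that by (auto simp: inj_on_def image_def)
  have "\<exists>i<l. f i \<noteq> g i"
  proof (rule ccontr)
    assume "\<not> (\<exists>i<l. f i \<noteq> g i)"
    then have "{j. j < l \<and> cycle_edge l f j \<in> X} = {j. j < l \<and> cycle_edge l g j \<in> X}"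
      by (auto simp: cycle_edge_def)
    then show False using less.prems by simp
  qed
  then obtain i where i: "i < l" "f i \<noteq> g i" by blast
  have gi: "g i < n" using i less.prems by auto
  show ?case
  proof (cases "g i \<in> f ` {..<l}")
    case False
    have inj: "?inj (f(i := g i))" using upd[of f i "g i"] False i gi less.prems by blast
    from step[OF inj less.prems(6) i(1)] show ?thesis
    proof
      assume c: "?c (f(i := g i)) < s"
      have "card (?D (f(i := g i))) < card (?D f)"
        by (rule psubset_card_mono) (use i in auto)
      then show ?thesis using less.hyps[of "f(i := g i)"] inj less.prems c by blast
    qed blast
  next
    case True
    \<comment> \<open>The wanted vertex \<open>g i\<close> is occupied by position \<open>j\<close>,
      which is first moved to a spare vertex \<open>z\<close>. Position \<open>j\<close> disagreed
      with \<open>g\<close> already, so the two moves together still lower the number of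
      disagreements.\<close>
    then obtain j where j: "j < l" "f j = g i" by auto
    have ji: "j \<noteq> i" using i j by auto
    then have gj: "g j \<noteq> g i" using i j less.prems by (auto simp: inj_on_eq_iff)
    have "card (f ` {..<l}) < card {..<n}" using card_image_le[of "{..<l}" f] less.prems by simp
    then have "\<not> {..<n} \<subseteq> f ` {..<l}" using card_mono[of "f ` {..<l}" "{..<n}"] by fastforce
    then obtain z where z: "z < n" "z \<notin> f ` {..<l}" by auto
    have inj: "?inj (f(j := z))" using upd[of f j z] z j less.prems by blast
    from step[OF inj less.prems(6) j(1)] show ?thesis
    proof
      assume c: "?c (f(j := z)) < s"
      have "g i \<notin> (f(j := z)) ` {..<l}" using z j ji True less.prems(1) by (auto simp: inj_on_eq_iff)
      then have inj2: "?inj (f(j := z, i := g i))" using upd[OF inj i(1) gi] by blast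
      from step[OF inj2 c i(1)] show ?thesis
      proof
        assume c2: "?c (f(j := z, i := g i)) < s"
        have "card (?D (f(j := z, i := g i))) < card (?D f)"
          by (rule psubset_card_mono) (use i j ji gj in auto)
        then show ?thesis using less.hyps[of "f(j := z, i := g i)"] inj2 less.prems c2 by blast
      qed blast
    qed blast
  qed
qed

section \<open>Balanced odd cycles from dense color classes\<close>

lemma finite_K_edges: "finite (K_edges n)"
  unfolding K_edges_def by (rule finite_edges[of "{..<n}"]) auto

text \<open>The classes may overlap, so \<open>E1\<close> is chosen between the edges that must be
  red, \<open>F - B\<close>, and those that may be red. At most \<open>s + 1\<close> edges are not
  blue, hence \<open>E1\<close> can have size \<open>s\<close> or \<open>s + 1\<close>.\<close>

lemma balanced_splitting:
  assumes "card F = 2 * s + 1" "F \<subseteq> R \<union> B" "s \<le> card (F \<inter> R)" "s \<le> card (F \<inter> B)"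
  shows "\<exists>E1 E2. F = E1 \<union> E2 \<and> E1 \<inter> E2 = {} \<and> E1 \<subseteq> R \<and> E2 \<subseteq> B \<and>
    \<bar>int (card E1) - int (card E2)\<bar> \<le> 1"
proof -
  have fin: "finite F" using assms(1) by (intro card_ge_0_finite) simp
  have FB: "card (F - B) = card F - card (F \<inter> B)"
    using fin by (simp add: card_Diff_subset_Int)
  have "F - B \<subseteq> F \<inter> R" using assms(2) by auto
  moreover from this have "card (F - B) \<le> card (F \<inter> R)" using fin by (intro card_mono) auto
  ultimately obtain E1 where E1: "F - B \<subseteq> E1" "E1 \<subseteq> F \<inter> R" "card E1 = max s (card (F - B))"
    using exists_subset_between[of "F - B" "max s (card (F - B))" "F \<inter> R"] fin assms(3) by auto
  have "card (F - E1) = card F - card E1"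
    using fin E1 by (intro card_Diff_subset finite_subset[of E1 F]) auto
  moreover have "card E1 = s \<or> card E1 = s + 1"
    using E1(3) FB assms(1,4) by (auto simp: max_def)
  ultimately have "\<bar>int (card E1) - int (card (F - E1))\<bar> \<le> 1" using assms(1) by auto
  then show ?thesis using E1 by (intro exI[of _ E1] exI[of _ "F - E1"]) auto
qed

text \<open>If \<open>f\<close> has too few blue edges, interpolation towards \<open>g\<close> gives
  a cycle with \<open>s\<close> or \<open>s + 1\<close> of them; its at least \<open>s\<close> other
  edges must be red.\<close>

lemma has_balanced_cycle:
  assumes "K_edges n \<subseteq> R \<union> B" "1 \<le> s" "2 * s + 1 < n"
    and f: "inj_on f {..<2 * s + 1}" "f ` {..<2 * s + 1} \<subseteq> {..<n}"
      "s \<le> card {i. i < 2 * s + 1 \<and> cycle_edge (2 * s + 1) f i \<in> R}"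
    and g: "inj_on g {..<2 * s + 1}" "g ` {..<2 * s + 1} \<subseteq> {..<n}"
      "s \<le> card {i. i < 2 * s + 1 \<and> cycle_edge (2 * s + 1) g i \<in> B}"
  shows "has_balanced_copy n (cycle_graph (2 * s + 1)) R B"
proof -
  let ?l = "2 * s + 1"
  have l3: "3 \<le> ?l" using assms by simp
  have balanced: "has_balanced_copy n (cycle_graph ?l) R B"
    if h: "inj_on h {..<?l}" "h ` {..<?l} \<subseteq> {..<n}"
      and R: "s \<le> card (cycle_edge ?l h ` {..<?l} \<inter> R)"
      and B: "s \<le> card (cycle_edge ?l h ` {..<?l} \<inter> B)" for h
  proof -
    have "cycle_edge ?l h ` {..<?l} \<subseteq> R \<union> B" using cycle_edges_in_K[OF h l3] assms(1) by blast
    moreover have "card (cycle_edge ?l h ` {..<?l}) = ?l"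
      using inj_cycle_edge[OF h(1) l3] by (simp add: card_image)
    ultimately obtain E1 E2 where "cycle_edge ?l h ` {..<?l} = E1 \<union> E2 \<and> E1 \<inter> E2 = {} \<and>
        E1 \<subseteq> R \<and> E2 \<subseteq> B \<and> \<bar>int (card E1) - int (card E2)\<bar> \<le> 1"
      using balanced_splitting[OF _ _ R B] by blast
    moreover have "copy_in_K n (cycle_graph ?l) (cycle_edge ?l h ` {..<?l})"
      unfolding copy_in_K_cycle_iff using h by blast
    ultimately show ?thesis unfolding has_balanced_copy_def by blast
  qed
  show ?thesis
  proof (cases "s \<le> card {i. i < ?l \<and> cycle_edge ?l f i \<in> B}")
    case True
    then show ?thesis using balanced[OF f(1,2)] f(3) card_inter_cycle[OF f(1) l3] by simp
  next
    case False
    then obtain h where h: "inj_on h {..<?l}" "h ` {..<?l} \<subseteq> {..<n}"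
        "card {j. j < ?l \<and> cycle_edge ?l h j \<in> B} \<in> {s, s + 1}"
      using cycle_interpolation[OF f(1,2) g(1,2) assms(3), of B s] g(3) by auto
    let ?F = "cycle_edge ?l h ` {..<?l}"
    have "card ?F = ?l" using inj_cycle_edge[OF h(1) l3] by (simp add: card_image)
    moreover have FB: "card (?F \<inter> B) \<in> {s, s + 1}" using h(3) card_inter_cycle[OF h(1) l3] by simp
    moreover have "card (?F - B) \<le> card (?F \<inter> R)"
      using cycle_edges_in_K[OF h(1,2) l3] assms(1) by (intro card_mono) auto
    ultimately have "s \<le> card (?F \<inter> R)" by (auto simp: card_Diff_subset_Int)
    then show ?thesis using balanced[OF h(1,2)] FB by auto
  qed
qed

text \<open>The list from \<open>dense_path\<close> has \<open>2 * s\<close> vertices; one fresh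
  vertex \<open>z\<close> brings it to odd length, and closing it up loses no counted edge.\<close>

lemma dense_cycle:
  assumes "E \<subseteq> K_edges n" "c \<le> 1" "20 * j + 7 \<le> n" "2 * j * n + 2 * c < 2 * card E + j * (j + 1)"
    and s: "s = 2 * j + 1 + c"
  shows "\<exists>f. inj_on f {..<2 * s + 1} \<and> f ` {..<2 * s + 1} \<subseteq> {..<n} \<and>
    s \<le> card {i. i < 2 * s + 1 \<and> cycle_edge (2 * s + 1) f i \<in> E}"
proof -
  let ?l = "2 * s + 1"
  obtain xs where xs: "distinct xs" "set xs \<subseteq> {..<n}" "length xs = 2 * s" "s \<le> edge_count E xs"
    using dense_path[of "{..<n}" E c j] assms by (auto simp: K_edges_def)
  have "card (set xs) < card {..<n}" using xs distinct_card[of xs] assms by simp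
  then have "\<not> {..<n} \<subseteq> set xs" using card_mono[of "set xs" "{..<n}"] by fastforce
  then obtain z where z: "z < n" "z \<notin> set xs" by auto
  define ys where "ys = xs @ [z]"
  have ys: "distinct ys" "set ys \<subseteq> {..<n}" "length ys = ?l" using xs z by (auto simp: ys_def)
  have "s \<le> edge_count E ys" using edge_count_append[of E xs "[z]"] xs(4) by (simp add: ys_def)
  also have "\<dots> = card {i. Suc i < ?l \<and> {ys ! i, ys ! Suc i} \<in> E}"
    by (simp add: edge_count_eq_card ys(3))
  also have "\<dots> \<le> card {i. i < ?l \<and> cycle_edge ?l ((!) ys) i \<in> E}"
    by (rule card_mono) (auto simp: cycle_edge_def)
  finally have count: "s \<le> card {i. i < ?l \<and> cycle_edge ?l ((!) ys) i \<in> E}" .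
  have "inj_on ((!) ys) {..<?l}" using ys by (auto simp: inj_on_def nth_eq_iff_index_eq)
  moreover have "(!) ys ` {..<?l} \<subseteq> {..<n}" by (metis image_subsetI lessThan_iff nth_mem subsetD ys(2,3))
  ultimately show ?thesis using count by blast
qed

section \<open>From balanced cycles to balanced paths\<close>

text \<open>The path starts right after the deleted edge: the rotation \<open>?p\<close> runs
  through \<open>i + 1, i + 2, ...\<close> cyclically and ends at \<open>i\<close>.\<close>

lemma cycle_minus_edge_is_path:
  assumes "inj_on f {..<Suc m}" "f ` {..<Suc m} \<subseteq> {..<n}" "2 \<le> m" "i < Suc m"
  shows "copy_in_K n (path_graph m) (cycle_edge (Suc m) f ` {..<Suc m} - {cycle_edge (Suc m) f i})"
proof -
  let ?p = "\<lambda>j. (i + 1 + j) mod Suc m"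
  have "inj_on ?p {..m}"
  proof (rule inj_onI)
    fix a b assume ab: "a \<in> {..m}" "b \<in> {..m}" "?p a = ?p b"
    \<comment> \<open>As \<open>i + 1 + c\<close> is below \<open>2 * Suc m\<close>, reduction
      modulo \<open>Suc m\<close> subtracts at most once.\<close>
    have p: "?p c = (if i + 1 + c < Suc m then i + 1 + c else i + c - m)" if "c \<le> m" for c
      using assms(4) that by (auto simp: le_mod_geq)
    have "(if i + 1 + a < Suc m then i + 1 + a else i + a - m) =
        (if i + 1 + b < Suc m then i + 1 + b else i + b - m)"
      using ab(3) unfolding p[OF ab(1)[unfolded atMost_iff]] p[OF ab(2)[unfolded atMost_iff]] .
    then show "a = b" using ab assms(4) by (auto split: if_splits)
  qed
  note inj = this
  have sub: "?p ` {..m} \<subseteq> {..m}" using mod_less_divisor[of "Suc m"] by (auto simp: less_Suc_eq_le)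
  have surj: "?p ` {..m} = {..m}" using endo_inj_surj[OF _ sub inj] by simp
  have last: "?p m = i"
  proof -
    have "i + 1 + m = i + Suc m" by simp
    then show ?thesis using assms(4) by (simp only: mod_add_self2 mod_less)
  qed
  have "{..<m} = {..m} - {m}" by auto
  then have "?p ` {..<m} = {..m} - {i}"
    using inj_on_image_set_diff[OF inj, of "{..m}" "{m}"] surj last by simp
  then have img: "?p ` {..<m} = {..<Suc m} - {i}" by auto
  have "{(f \<circ> ?p) j, (f \<circ> ?p) (Suc j)} = cycle_edge (Suc m) f (?p j)" for j
    by (simp add: cycle_edge_def mod_Suc_eq)
  then have "(\<lambda>j. {(f \<circ> ?p) j, (f \<circ> ?p) (Suc j)}) ` {..<m} = cycle_edge (Suc m) f ` ({..<Suc m} - {i})"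
    unfolding img[symmetric] by (simp add: image_image)
  also have "\<dots> = cycle_edge (Suc m) f ` {..<Suc m} - {cycle_edge (Suc m) f i}"
    using inj_on_image_set_diff[OF inj_cycle_edge[OF assms(1)], of "{..<Suc m}" "{i}"] assms by simp
  finally have "(\<lambda>j. {(f \<circ> ?p) j, (f \<circ> ?p) (Suc j)}) ` {..<m}
      = cycle_edge (Suc m) f ` {..<Suc m} - {cycle_edge (Suc m) f i}" .
  moreover have "inj_on (f \<circ> ?p) {..m}"
    using inj assms(1) surj by (intro comp_inj_on) (auto simp: lessThan_Suc_atMost)
  moreover have "(f \<circ> ?p) ` {..m} \<subseteq> {..<n}"
    using assms(2) surj by (simp only: image_comp[symmetric] lessThan_Suc_atMost)
  ultimately show ?thesis unfolding copy_in_K_path_iff by blast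
qed

text \<open>An odd total forces parts of sizes \<open>s\<close> and \<open>s + 1\<close>; dropping
  an edge of the larger part makes them equal.\<close>

lemma has_balanced_path_of_cycle:
  assumes "has_balanced_copy n (cycle_graph (2 * s + 1)) R B" "1 \<le> s"
  shows "has_balanced_copy n (path_graph (2 * s)) R B"
proof -
  let ?l = "Suc (2 * s)"
  obtain F E1 E2 where copy: "copy_in_K n (cycle_graph ?l) F" and F2: "F = E1 \<union> E2"
    and E: "E1 \<inter> E2 = {}" "E1 \<subseteq> R" "E2 \<subseteq> B" "\<bar>int (card E1) - int (card E2)\<bar> \<le> 1"
    using assms(1) unfolding has_balanced_copy_def Suc_eq_plus1[symmetric] by (elim exE conjE)
  obtain f where f: "inj_on f {..<?l}" "f ` {..<?l} \<subseteq> {..<n}" and F1: "F = cycle_edge ?l f ` {..<?l}"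
    using copy unfolding copy_in_K_cycle_iff by blast
  have "finite F" unfolding F1 by simp
  then have fin: "finite E1" "finite E2" using F2 by simp_all
  have "card F = ?l"
    unfolding F1 using inj_cycle_edge[OF f(1)] assms(2) by (simp add: card_image)
  then have sum: "card E1 + card E2 = ?l" using E(1) F2 fin by (simp add: card_Un_disjoint)
  have path: "copy_in_K n (path_graph (2 * s)) (F - {e})" if "e \<in> F" for e
    using cycle_minus_edge_is_path[OF f(1,2)] that assms(2) unfolding F1 by auto
  show ?thesis
  proof (cases "card E1 < card E2")
    case True
    then have "E2 \<noteq> {}" by auto
    then obtain e where e: "e \<in> E2" by blast
    have "card (E2 - {e}) = card E1" using e sum True E(4) by simp
    moreover have "F - {e} = E1 \<union> (E2 - {e})" "E1 \<inter> (E2 - {e}) = {}" "E2 - {e} \<subseteq> B" "e \<in> F"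
      using e E F2 by auto
    ultimately show ?thesis unfolding has_balanced_copy_def
      using path[of e] E(2) by (intro exI[of _ "F - {e}"] exI[of _ E1] exI[of _ "E2 - {e}"]) simp
  next
    case False
    then have "card E1 > card E2" using sum by presburger
    then have "E1 \<noteq> {}" by auto
    then obtain e where e: "e \<in> E1" by blast
    have "card (E1 - {e}) = card E2" using e sum \<open>card E1 > card E2\<close> E(4) by simp
    moreover have "F - {e} = (E1 - {e}) \<union> E2" "(E1 - {e}) \<inter> E2 = {}" "E1 - {e} \<subseteq> R" "e \<in> F"
      using e E F2 by auto
    ultimately show ?thesis unfolding has_balanced_copy_def
      using path[of e] E(3) by (intro exI[of _ "F - {e}"] exI[of _ "E1 - {e}"] exI[of _ E2]) simp
  qed
qed

section \<open>The extremal coloring\<close>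

lemma cycle_degree_le_2:
  assumes "copy_in_K n (cycle_graph l) F"
  shows "card {e \<in> F. x \<in> e} \<le> 2"
proof -
  obtain f where f: "inj_on f {..<l}" "F = cycle_edge l f ` {..<l}"
    using assms unfolding copy_in_K_cycle_iff by blast
  show ?thesis
  proof (cases "x \<in> f ` {..<l}")
    case False
    have "x \<notin> e" if "e \<in> F" for e
    proof
      assume "x \<in> e"
      with that f obtain i where "i < l" "x = f i \<or> x = f (Suc i mod l)"
        by (auto simp: cycle_edge_def)
      moreover from this have "Suc i mod l < l" by simp
      ultimately show False using False by auto
    qed
    then have "{e \<in> F. x \<in> e} = {}" by blast
    then show ?thesis by (simp only: card.empty)
  next
    case True
    then obtain i where i: "i < l" "x = f i" by auto
    let ?i' = "if i = 0 then l - 1 else i - 1"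
    have "{e \<in> F. x \<in> e} \<subseteq> {cycle_edge l f i, cycle_edge l f ?i'}"
    proof
      fix e assume "e \<in> {e \<in> F. x \<in> e}"
      then obtain j where j: "j < l" "e = cycle_edge l f j" "f i = f j \<or> f i = f (Suc j mod l)"
        using f i by (auto simp: cycle_edge_def)
      moreover have "Suc j mod l < l" using j by simp
      ultimately have "i = j \<or> i = Suc j mod l" using f(1) i by (auto simp: inj_on_eq_iff)
      then have "j = i \<or> j = ?i'" using j(1) by (auto simp: mod_Suc split: if_splits)
      then show "e \<in> {cycle_edge l f i, cycle_edge l f ?i'}" using j(2) by blast
    qed
    then have "card {e \<in> F. x \<in> e} \<le> card {cycle_edge l f i, cycle_edge l f ?i'}"
      by (intro card_mono) auto
    then show ?thesis by (auto simp: card_insert_if split: if_splits)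
  qed
qed

lemma path_degree_le_2:
  assumes "copy_in_K n (path_graph l) F"
  shows "card {e \<in> F. x \<in> e} \<le> 2"
proof -
  obtain f where f: "inj_on f {..l}" "F = (\<lambda>i. {f i, f (Suc i)}) ` {..<l}"
    using assms unfolding copy_in_K_path_iff by blast
  \<comment> \<open>At the ends of the path the list of two edges is only a superset: for
    \<open>i = 0\<close> truncated subtraction makes them coincide, and for \<open>i = l\<close> the
    first lies beyond the path.\<close>
  have "\<exists>i. {e \<in> F. x \<in> e} \<subseteq> {{f i, f (Suc i)}, {f (i - 1), f (Suc (i - 1))}}"
  proof (cases "x \<in> f ` {..l}")
    case False
    then have "{e \<in> F. x \<in> e} = {}" using f(2) by auto
    then show ?thesis by (simp only: empty_subsetI simp_thms)
  next
    case True
    then obtain i where i: "i \<le> l" "x = f i" by auto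
    have "j = i \<or> j = i - 1" if "j < l" "f i = f j \<or> f i = f (Suc j)" for j
      using that inj_onD[OF f(1), of i j] inj_onD[OF f(1), of i "Suc j"] i by auto
    then show ?thesis using f(2) i(2) by (intro exI[of _ i]) auto
  qed
  then obtain i where "{e \<in> F. x \<in> e} \<subseteq> {{f i, f (Suc i)}, {f (i - 1), f (Suc (i - 1))}}" ..
  then have "card {e \<in> F. x \<in> e} \<le> card {{f i, f (Suc i)}, {f (i - 1), f (Suc (i - 1))}}"
    by (intro card_mono) auto
  also have "\<dots> \<le> 2" by (simp add: card_insert_if)
  finally show ?thesis .
qed

lemma card_cycle_copy:
  assumes "copy_in_K n (cycle_graph l) F" "3 \<le> l"
  shows "card F = l"
  using assms(1) inj_cycle_edge[OF _ assms(2)] by (fastforce simp: copy_in_K_cycle_iff card_image)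

lemma card_path_copy:
  assumes "copy_in_K n (path_graph l) F"
  shows "card F = l"
proof -
  obtain f where f: "inj_on f {..l}" "F = (\<lambda>i. {f i, f (Suc i)}) ` {..<l}"
    using assms unfolding copy_in_K_path_iff by blast
  have "inj_on (\<lambda>i. {f i, f (Suc i)}) {..<l}"
  proof (rule inj_onI)
    fix i j assume ij: "i \<in> {..<l}" "j \<in> {..<l}" "{f i, f (Suc i)} = {f j, f (Suc j)}"
    then have "f i = f j \<or> (f i = f (Suc j) \<and> f (Suc i) = f j)" by (auto simp: doubleton_eq_iff)
    then show "i = j"
      using ij(1,2) inj_onD[OF f(1), of i j] inj_onD[OF f(1), of i "Suc j"]
        inj_onD[OF f(1), of "Suc i" j] by auto
  qed
  then show ?thesis using f(2) by (simp add: card_image)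
qed

text \<open>Each vertex of \<open>S\<close> accounts for at most two edges of the copy, so
  \<open>E1\<close> has at most \<open>s - 1\<close> edges. Then \<open>E2\<close> has at least
  \<open>s + 1\<close>, a difference of at least 2.\<close>

lemma no_balanced_copy:
  assumes "\<And>F. copy_in_K n G F \<Longrightarrow> 2 * s \<le> card F"
    and deg: "\<And>F x. copy_in_K n G F \<Longrightarrow> card {e \<in> F. x \<in> e} \<le> 2"
    and R: "R \<subseteq> {e. e \<inter> S \<noteq> {}} \<union> T" "finite S" "finite T" "2 * card S + card T < s"
  shows "\<not> has_balanced_copy n G R B"
proof
  assume "has_balanced_copy n G R B"
  then obtain F E1 E2 where F: "copy_in_K n G F" "F = E1 \<union> E2" "E1 \<inter> E2 = {}" "E1 \<subseteq> R"
      "\<bar>int (card E1) - int (card E2)\<bar> \<le> 1"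
    unfolding has_balanced_copy_def by blast
  have "0 < card F" using assms(1)[OF F(1)] R(4) by linarith
  then have fin: "finite F" by (rule card_ge_0_finite)
  have "E1 \<subseteq> (\<Union>x\<in>S. {e \<in> F. x \<in> e}) \<union> T" using F R(1) by auto
  then have "card E1 \<le> card ((\<Union>x\<in>S. {e \<in> F. x \<in> e}) \<union> T)"
    using fin R by (intro card_mono) auto
  also have "\<dots> \<le> card (\<Union>x\<in>S. {e \<in> F. x \<in> e}) + card T" by (rule card_Un_le)
  also have "card (\<Union>x\<in>S. {e \<in> F. x \<in> e}) \<le> (\<Sum>x\<in>S. card {e \<in> F. x \<in> e})"
    by (rule card_UN_le[OF R(2)])
  also have "\<dots> \<le> (\<Sum>x\<in>S. 2)" by (rule sum_mono) (rule deg[OF F(1)])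
  finally have "card E1 < s" using R(4) by simp
  moreover have "2 * s \<le> card E1 + card E2"
    using assms(1)[OF F(1)] F(2) card_Un_le[of E1 E2] by simp
  ultimately show False using F(5) by linarith
qed

lemma two_times_choose_two: "2 * (m choose 2) = m * (m - 1)"
proof -
  have "even (m * (m - 1))" by (cases m) auto
  then show ?thesis by (simp add: choose_two)
qed

text \<open>This shows the edge bound of \<open>dense_path\<close> to be sharp. The graph
  \<open>G\<close> is quantified after \<open>R\<close>, so that one coloring serves both the cycle
  and the path.\<close>

lemma sparse_unbalanced_coloring:
  assumes "c \<le> 1" "j + 2 \<le> n"
  shows "\<exists>R. R \<subseteq> K_edges n \<and> 2 * card R + j * (j + 1) = 2 * j * n + 2 * c \<and>
    (\<forall>G :: nat graph. \<forall>B. (\<forall>F. copy_in_K n G F \<longrightarrow>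
        2 * (2 * j + 1 + c) \<le> card F \<and> (\<forall>x. card {e \<in> F. x \<in> e} \<le> 2))
      \<longrightarrow> \<not> has_balanced_copy n G R B)"
proof -
  define T where "T = (if c = 1 then {{j, j + 1}} else {})"
  define A where "A = {e \<in> K_edges n. e \<inter> {..<j} \<noteq> {}}"
  have "c = 0 \<or> c = 1" using assms(1) by linarith
  then have cT: "card T = c" by (auto simp: T_def)
  have finT: "finite T" by (auto simp: T_def)
  \<comment> \<open>\<open>A\<close> is counted through its complement, a complete graph on
    \<open>n - j\<close> vertices.\<close>
  have A_compl: "K_edges n - A = {e. e \<subseteq> {j..<n} \<and> card e = 2}"
    unfolding A_def K_edges_def by (auto simp: subset_iff disjoint_iff)
  have AK: "A \<subseteq> K_edges n" by (auto simp: A_def)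
  have "card (K_edges n) = n choose 2" unfolding K_edges_def by (simp add: n_subsets)
  moreover have "card (K_edges n - A) = (n - j) choose 2" unfolding A_compl by (simp add: n_subsets)
  moreover have "card (K_edges n) = card A + card (K_edges n - A)"
    using AK finite_K_edges by (metis card_Diff_subset card_mono finite_subset le_add_diff_inverse)
  ultimately have "2 * (n choose 2) = 2 * card A + 2 * ((n - j) choose 2)" by simp
  then have "n * (n - 1) = 2 * card A + (n - j) * (n - j - 1)" by (simp only: two_times_choose_two)
  moreover obtain d where d: "n = j + d + 2" using assms(2) by (metis add.assoc add.commute le_Suc_ex)
  ultimately have "(j + d + 2) * (j + d + 1) = 2 * card A + (d + 2) * (d + 1)" by simp
  then have card_A: "2 * card A + j * (j + 1) = 2 * j * n"
    unfolding d by (simp add: algebra_simps)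
  have TK: "T \<subseteq> K_edges n" using assms(2) by (auto simp: T_def K_edges_def)
  have "A \<inter> T = {}" by (auto simp: A_def T_def split: if_splits)
  then have card_R: "card (A \<union> T) = card A + c"
    using finT cT finite_subset[OF AK finite_K_edges] by (simp add: card_Un_disjoint)
  show ?thesis
  proof (intro exI[of _ "A \<union> T"] conjI allI impI)
    show "2 * card (A \<union> T) + j * (j + 1) = 2 * j * n + 2 * c" using card_A card_R by simp
    fix G :: "nat graph" and B
    assume *: "\<forall>F. copy_in_K n G F \<longrightarrow>
        2 * (2 * j + 1 + c) \<le> card F \<and> (\<forall>x. card {e \<in> F. x \<in> e} \<le> 2)"
    show "\<not> has_balanced_copy n G (A \<union> T) B"
      by (rule no_balanced_copy[where s = "2 * j + 1 + c" and S = "{..<j}" and T = T])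
        (use * cT finT in \<open>auto simp: A_def\<close>)
  qed (use AK TK in auto)
qed

section \<open>Evaluation of the balancing numbers\<close>

lemma smallest_int_eqI:
  assumes "P v" "\<And>m. P m \<Longrightarrow> v \<le> m"
  shows "smallest_int P = Some v"
proof -
  have "(LEAST m. P m) = v" using assms by (rule Least_equality)
  then show ?thesis unfolding smallest_int_def using assms by auto
qed

text \<open>Through this the extremal 2-coloring also bounds \<open>lbal\<close> from below.\<close>

lemma color_class_two_coloring:
  assumes "two_coloring n R B"
  shows "\<exists>L. two_list_coloring n L \<and> color_class n L Red = R \<and> color_class n L Blue = B"
proof (intro exI conjI)
  let ?L = "\<lambda>e. if e \<in> R then {Red} else {Blue}"
  show "two_list_coloring n ?L" by (simp add: two_list_coloring_def)
  show "color_class n ?L Red = R" "color_class n ?L Blue = B"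
    using assms by (auto simp: color_class_def two_coloring_def)
qed

text \<open>The common value \<open>v\<close> is the number of red edges of the extremal coloring:
  more than \<open>v\<close> edges in each class force a balanced copy, and the coloring itself
  rules out every smaller value.\<close>

lemma balancing_numbers:
  assumes "c \<le> 1" "20 * j + 7 \<le> n" "s = 2 * j + 1 + c"
  shows "\<exists>v. 2 * v = 2 * int j * int n - int j * (int j + 1) + 2 * int c \<and>
    lbal n (cycle_graph (2 * s + 1)) = Some v \<and>
    bal n (cycle_graph (2 * s + 1)) = Some v \<and>
    bal n (path_graph (2 * s)) = Some v"
proof -
  let ?C = "cycle_graph (2 * s + 1)" and ?P = "path_graph (2 * s)"
  obtain R where R: "R \<subseteq> K_edges n" "2 * card R + j * (j + 1) = 2 * j * n + 2 * c"
    and unbalanced: "\<And>(G :: nat graph) B. (\<And>F. copy_in_K n G F \<Longrightarrow> 2 * s \<le> card F \<and> (\<forall>x. card {e \<in> F. x \<in> e} \<le> 2))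
      \<Longrightarrow> \<not> has_balanced_copy n G R B"
    using sparse_unbalanced_coloring[of c j n] assms by auto
  define v where "v = int (card R)"
  have v2: "2 * v = 2 * int j * int n - int j * (int j + 1) + 2 * int c"
    using arg_cong[OF R(2), of int] by (simp add: v_def algebra_simps)
  have sn: "1 \<le> s" "2 * s + 1 < n" using assms by auto
  have dense: "2 * j * n + 2 * c < 2 * card E + j * (j + 1)" if "int (card E) > v" for E :: "nat set set"
    using that R(2) by (simp add: v_def)
  have upper_C: "has_balanced_copy n ?C R' B'"
    if K: "R' \<subseteq> K_edges n" "B' \<subseteq> K_edges n" "K_edges n \<subseteq> R' \<union> B'"
      and v: "int (card R') > v" "int (card B') > v" for R' B'
  proof -
    from dense_cycle[OF K(1) assms(1,2) dense[OF v(1)] assms(3)]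
      dense_cycle[OF K(2) assms(1,2) dense[OF v(2)] assms(3)]
    show ?thesis using has_balanced_cycle[OF K(3) sn] by blast
  qed
  have upper_P: "has_balanced_copy n ?P R' B'"
    if "R' \<subseteq> K_edges n" "B' \<subseteq> K_edges n" "K_edges n \<subseteq> R' \<union> B'"
      "int (card R') > v" "int (card B') > v" for R' B'
    using upper_C[OF that] has_balanced_path_of_cycle sn(1) by blast
  define B where "B = K_edges n - R"
  have col: "two_coloring n R B" using R(1) by (auto simp: two_coloring_def B_def)
  have not_C: "\<not> has_balanced_copy n ?C R B"
    by (rule unbalanced) (use card_cycle_copy cycle_degree_le_2 sn in auto)
  have not_P: "\<not> has_balanced_copy n ?P R B"
    by (rule unbalanced) (use card_path_copy path_degree_le_2 in auto)
  \<comment> \<open>This makes \<open>v\<close> admissible in \<open>bal\<close>, and it also makes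
    the blue class of the extremal coloring larger than the red one.\<close>
  have "4 * (card R + 1) \<le> n * (n - 1)"
  proof -
    have "2 * card R \<le> 2 * j * n + 2" using R(2) assms(1) by linarith
    moreover have "n * (20 * j + 6) \<le> n * (n - 1)" using assms(2) by (intro mult_left_mono) auto
    moreover have "8 \<le> n * 6" using assms(2) by simp
    ultimately show ?thesis by (simp add: algebra_simps)
  qed
  then have choose: "2 * (card R + 1) \<le> n choose 2" using two_times_choose_two[of n] by linarith
  have "card (K_edges n) = n choose 2" unfolding K_edges_def by (simp add: n_subsets)
  then have "card B = (n choose 2) - card R"
    using R(1) unfolding B_def by (simp add: card_Diff_subset finite_subset finite_K_edges)
  then have card_B: "card R < card B" using choose by arith
  have lbal: "lbal n ?C = Some v" unfolding lbal_def
  proof (rule smallest_int_eqI)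
    show "card (gverts ?C) \<le> n \<and> (\<forall>L. two_list_coloring n L \<and>
        int (card (color_class n L Red)) > v \<and> int (card (color_class n L Blue)) > v
        \<longrightarrow> has_balanced_copy n ?C (color_class n L Red) (color_class n L Blue))"
    proof (intro conjI allI impI)
      fix L assume L: "two_list_coloring n L \<and>
        int (card (color_class n L Red)) > v \<and> int (card (color_class n L Blue)) > v"
      then have "K_edges n \<subseteq> color_class n L Red \<union> color_class n L Blue"
        by (fastforce simp: color_class_def two_list_coloring_def)
      then show "has_balanced_copy n ?C (color_class n L Red) (color_class n L Blue)"
        using L by (intro upper_C) (auto simp: color_class_def)
    qed (use sn in \<open>simp add: cycle_graph_def\<close>)
  next
    fix m assume m: "card (gverts ?C) \<le> n \<and> (\<forall>L. two_list_coloring n L \<and>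
        int (card (color_class n L Red)) > m \<and> int (card (color_class n L Blue)) > m
        \<longrightarrow> has_balanced_copy n ?C (color_class n L Red) (color_class n L Blue))"
    obtain L where L: "two_list_coloring n L" "color_class n L Red = R" "color_class n L Blue = B"
      using color_class_two_coloring[OF col] by blast
    then have "\<not> (int (card R) > m \<and> int (card B) > m)" using m not_C by auto
    \<comment> \<open>If \<open>m\<close> were below \<open>v\<close>, both \<open>R\<close> and
      \<open>B\<close> would have more than \<open>m\<close> edges.\<close>
    then show "v \<le> m" using card_B v_def by linarith
  qed
  \<comment> \<open>Stated for arbitrary \<open>G\<close>, to be applied to both the cycle and the
    path.\<close>
  have bal: "bal n G = Some v"
    if upper: "\<And>R' B'. R' \<subseteq> K_edges n \<Longrightarrow> B' \<subseteq> K_edges n \<Longrightarrow> K_edges n \<subseteq> R' \<union> B' \<Longrightarrow>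
        int (card R') > v \<Longrightarrow> int (card B') > v \<Longrightarrow> has_balanced_copy n G R' B'"
      and lower: "\<not> has_balanced_copy n G R B" for G :: "nat graph"
    unfolding bal_def
  proof (rule smallest_int_eqI)
    show "2 * (v + 1) \<le> int (n choose 2) \<and> (\<forall>R B. two_coloring n R B \<and>
        int (card R) > v \<and> int (card B) > v \<longrightarrow> has_balanced_copy n G R B)"
      using choose by (auto simp: v_def two_coloring_def intro!: upper[unfolded v_def])
  next
    fix m assume "2 * (m + 1) \<le> int (n choose 2) \<and> (\<forall>R B. two_coloring n R B \<and>
        int (card R) > m \<and> int (card B) > m \<longrightarrow> has_balanced_copy n G R B)"
    then have "\<not> (int (card R) > m \<and> int (card B) > m)" using col lower by blast
    then show "v \<le> m" using card_B v_def by linarith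
  qed
  show ?thesis
    using v2 lbal bal[of ?C, OF upper_C not_C] bal[of ?P, OF upper_P not_P] by blast
qed

theorem theorem8:
  fixes k n :: nat and \<alpha> :: int
  assumes "k \<ge> 1"
    and "real n \<ge> 9 / 2 * (real k)\<^sup>2 + 13 / 4 * real k + 49 / 32"
    and "\<alpha> \<in> {-1, 1}"
  shows "\<exists>v :: int.
      real_of_int v = (real k - 1) * real n
        - 1 / 2 * ((real k)\<^sup>2 - real k - 1 - real_of_int \<alpha>) \<and>
      lbal n (cycle_graph (nat (4 * int k + \<alpha>))) = Some v \<and>
      bal n (cycle_graph (nat (4 * int k + \<alpha>))) = Some v \<and>
      bal n (path_graph (nat (4 * int k + \<alpha> - 1))) = Some v"
proof -
  obtain j where j: "k = Suc j" using assms(1) by (cases k) auto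
  \<comment> \<open>With \<open>j = k - 1\<close>, the length \<open_placeholder>\<close>
  define c where "c = (if \<alpha> = 1 then 1 else 0 :: nat)"
  define s where "s = 2 * j + 1 + c"
  have \<alpha>: "\<alpha> = 2 * int c - 1" using assms(3) by (auto simp: c_def)
  have "real (144 * (k * k) + 104 * k + 49) \<le> real (32 * n)"
    using assms(2) by (simp add: power2_eq_square)
  then have large: "144 * (k * k) + 104 * k + 49 \<le> 32 * n" by (simp only: of_nat_le_iff)
  have "20 * j + 7 \<le> n"
  proof (cases "j \<le> 1")
    case True
    then consider "j = 0" | "j = 1" by linarith
    then show ?thesis by cases (use large j in auto)
  next
    case False
    then have "2 * j \<le> j * j" by (intro mult_right_mono) auto
    moreover have "144 * (k * k) + 104 * k + 49 = 144 * (j * j) + 392 * j + 297"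
      unfolding j by (simp add: algebra_simps)
    ultimately show ?thesis using large by linarith
  qed
  moreover have "c \<le> 1" by (simp add: c_def)
  ultimately obtain v where
    v: "2 * v = 2 * int j * int n - int j * (int j + 1) + 2 * int c" and
    bal: "lbal n (cycle_graph (2 * s + 1)) = Some v" "bal n (cycle_graph (2 * s + 1)) = Some v"
      "bal n (path_graph (2 * s)) = Some v"
    using balancing_numbers[OF _ _ s_def] by blast
  have "nat (4 * int k + \<alpha>) = 2 * s + 1" "nat (4 * int k + \<alpha> - 1) = 2 * s"
    unfolding \<alpha> j s_def by simp_all
  moreover have "real_of_int v = (real k - 1) * real n
      - 1 / 2 * ((real k)\<^sup>2 - real k - 1 - real_of_int \<alpha>)"
    using arg_cong[OF v, of real_of_int] unfolding \<alpha> j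
    by (simp add: power2_eq_square algebra_simps)
  ultimately show ?thesis using bal by auto
qed

end
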